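(* Suppose that $H$ is a subgroup of $PL_+(I)$ generated by a finite set $Z$ of one-bump functions with fundamental domains, and let $S_Z$ be the set of signed orbitals associated to the elements of $Z$. Then $H$ is a soluble group, and the derived length of $H$ is the largest height of a tower of signed orbitals contained in the set $S_Z$.
   Context: $PL_+(I)$ is the group of orientation-preserving piecewise-linear homeomorphisms of $I=[0,1]$ with finitely many breaks in slope, acting on the right ($x\cdot g$ is the image of $x$ under $g$). The support of $g$ is $\{x\in[0,1] : xg\ne x\}$; an orbital (component of support) of $g$ is a connected component (open interval) of its support. A signed orbital is a pair $(A,g)$ with $g\in PL_+(I)$ and $A$ an orbital of $g$. A set $X\subset PL_+(I)$ is a set of one-bump functions with fundamental domains if: (Z0) Each $h\in X$ has exactly one component of support, denoted $A_h$. (Z1) No pair of elements of $X$ forms a transition chain or a one-sided overlap. (Two elements with components of support $(a,b)$ and $(c,d)$, respectively, with $a<c<b<d$ form a transition chain; two elements with components of support $(a,b),(a,c)$ or $(a,b),(c,b)$, respectively, with $a<c<b$ form a one-sided overlap.) (Z2) If $h,h'\in X$ and $h\ne h'$, then $A_h\neq A_{h'}$. (Z3) For each $h\in X$ there is an $r_h\in A_h$ such that for every $h'\in X$ with $A_{h'}\subsetneq A_h$, the containment $A_{h'}\subseteq (r_h,r_h\cdot h)$ also holds. Thus $S_Z=\{(A_h,h) : h\in Z\}$. A tower is a set $\mathscr{T}$ of signed orbitals such that whenever $(A,g),(B,h)\in\mathscr{T}$: $A\subseteq B$ or $B\subseteq A$; and $A=B$ implies $g=h$. The height of $\mathscr{T}$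 is its cardinality (the empty tower has height $0$). The trivial group is soluble of derived length $0$. *)

theory Defs
  imports "HOL-Analysis.Analysis" "HOL-Algebra.Solvable_Groups"
begin

section \<open>The group of piecewise-linear homeomorphisms of the unit interval\<close>

text \<open>Affine on every subinterval that has no point of some finite set in its interior.\<close>

definition piecewise_linear :: "(real \<Rightarrow> real) \<Rightarrow> bool" where
  "piecewise_linear f \<longleftrightarrow>
     (\<exists>B. finite B \<and>
        (\<forall>x y. 0 \<le> x \<longrightarrow> x < y \<longrightarrow> y \<le> 1 \<longrightarrow> {x<..<y} \<inter> B = {} \<longrightarrow>
           (\<exists>m c. \<forall>t\<in>{x..y}. f t = m * t + c)))"

text \<open>
  Maps on \<open>[0,1]\<close> are represented by functions that are extensional on \<open>[0,1]\<close>, so that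
  equality of functions is equality of maps.
  The action is on the right: the image of \<open>x\<close> under \<open>g\<close> is \<open>g x\<close>, and in the product
  of \<open>f\<close> and \<open>g\<close> the map \<open>f\<close> is applied first.
\<close>

definition PL_plus :: "(real \<Rightarrow> real) monoid" where
  "PL_plus =
     \<lparr>carrier = {f \<in> extensional {0..1}.
                   (\<exists>g. homeomorphism {0..1} {0..1} f g) \<and>
                   strict_mono_on {0..1} f \<and> piecewise_linear f},
      mult = (\<lambda>f g. compose {0..1} g f),
      one = (\<lambda>x\<in>{0..1}. x)\<rparr>"

lemma piecewise_linear_compose:
  assumes f: "strict_mono_on {0..1} f" "f ` {0..1} = {0..1}" "piecewise_linear f"
    and g: "piecewise_linear g"
  shows "piecewise_linear (compose {0..1} g f)"
proof -
  obtain B where B: "finite B" "\<And>x y. 0 \<le> x \<Longrightarrow> x < y \<Longrightarrow> y \<le> 1 \<Longrightarrow> {x<..<y} \<inter> B = {}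
       \<Longrightarrow> \<exists>m c. \<forall>t\<in>{x..y}. f t = m * t + c"
    using f(3) unfolding piecewise_linear_def by metis
  obtain C where C: "finite C" "\<And>x y. 0 \<le> x \<Longrightarrow> x < y \<Longrightarrow> y \<le> 1 \<Longrightarrow> {x<..<y} \<inter> C = {}
       \<Longrightarrow> \<exists>m c. \<forall>t\<in>{x..y}. g t = m * t + c"
    using g unfolding piecewise_linear_def by metis
  have inj: "inj_on f {0..1}"
    using f(1) by (rule strict_mono_on_imp_inj_on)
  have mono: "f s < f t" if "0 \<le> s" "s < t" "t \<le> 1" for s t
    using strict_mono_onD[OF f(1)] that by auto
  have leq: "f s \<le> f t" if "0 \<le> s" "s \<le> t" "t \<le> 1" for s t
    using mono[of s t] that by (cases "s = t") auto
  have rng: "0 \<le> f t \<and> f t \<le> 1" if "0 \<le> t" "t \<le> 1" for t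
    using f(2) that by (metis atLeastAtMost_iff imageI)
  define D where "D = B \<union> (f -` C \<inter> {0..1})"
  have "finite D"
    unfolding D_def using B(1) C(1) inj by (simp add: finite_vimage_IntI)
  moreover have "\<exists>m c. \<forall>t\<in>{x..y}. compose {0..1} g f t = m * t + c"
    if xy: "0 \<le> x" "x < y" "y \<le> 1" "{x<..<y} \<inter> D = {}" for x y
  proof -
    have "{x<..<y} \<inter> B = {}"
      using xy(4) unfolding D_def by auto
    then obtain m c where mc: "\<forall>t\<in>{x..y}. f t = m * t + c"
      using B(2) xy by blast
    have "{f x<..<f y} \<inter> C = {}"
    proof (rule ccontr)
      assume "{f x<..<f y} \<inter> C \<noteq> {}"
      then obtain s where s: "f x < s" "s < f y" "s \<in> C"
        by auto
      have "s \<in> {0..1}"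
        using s rng[of x] rng[of y] xy by auto
      then obtain t where t: "t \<in> {0..1}" "s = f t"
        using f(2) by (metis imageE)
      have "x < t"
        using leq[of t x] s t xy by fastforce
      moreover have "t < y"
        using leq[of y t] s t xy by fastforce
      ultimately show False
        using xy(4) t s unfolding D_def by auto
    qed
    then obtain m' c' where mc': "\<forall>t\<in>{f x..f y}. g t = m' * t + c'"
      using C(2)[of "f x" "f y"] rng[of x] rng[of y] mono[of x y] xy by auto
    have "compose {0..1} g f t = (m' * m) * t + (m' * c + c')" if t: "t \<in> {x..y}" for t
    proof -
      have "f t \<in> {f x..f y}"
        using leq[of x t] leq[of t y] t xy by auto
      then have "g (f t) = m' * f t + c'"
        using mc' by blast
      then show ?thesis
        using mc t xy by (auto simp: compose_def algebra_simps)
    qed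
    then show ?thesis
      by blast
  qed
  ultimately show ?thesis
    unfolding piecewise_linear_def by blast
qed

lemma piecewise_linear_inverse:
  assumes f: "strict_mono_on {0..1} f" "homeomorphism {0..1} {0..1} f g" "piecewise_linear f"
  shows "strict_mono_on {0..1} g" and "piecewise_linear (restrict g {0..1})"
proof -
  obtain B where B: "finite B" "\<And>x y. 0 \<le> x \<Longrightarrow> x < y \<Longrightarrow> y \<le> 1 \<Longrightarrow> {x<..<y} \<inter> B = {}
       \<Longrightarrow> \<exists>m c. \<forall>t\<in>{x..y}. f t = m * t + c"
    using f(3) unfolding piecewise_linear_def by metis
  have fg: "f (g t) = t" and rng: "0 \<le> g t \<and> g t \<le> 1" if "0 \<le> t" "t \<le> 1" for t
    using f(2) that by (auto simp: homeomorphism_def)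
  have mono: "f s < f t" if "0 \<le> s" "s < t" "t \<le> 1" for s t
    using strict_mono_onD[OF f(1)] that by auto
  have gmono: "g s < g t" if "0 \<le> s" "s < t" "t \<le> 1" for s t
  proof (rule ccontr)
    assume "\<not> g s < g t"
    then consider "g t < g s" | "g t = g s"
      by linarith
    then show False
      using mono[of "g t" "g s"] fg[of s] fg[of t] rng[of s] rng[of t] that by cases auto
  qed
  show sm: "strict_mono_on {0..1} g"
    by (intro strict_mono_onI) (use gmono in auto)
  have "\<exists>m c. \<forall>t\<in>{x..y}. restrict g {0..1} t = m * t + c"
    if xy: "0 \<le> x" "x < y" "y \<le> 1" "{x<..<y} \<inter> f ` B = {}" for x y
  proof -
    have lt: "g x < g y"
      using gmono xy by auto
    have "{g x<..<g y} \<inter> B = {}"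
    proof (rule ccontr)
      assume "{g x<..<g y} \<inter> B \<noteq> {}"
      then obtain b where b: "g x < b" "b < g y" "b \<in> B"
        by auto
      have "x < f b" "f b < y"
        using mono[of "g x" b] mono[of b "g y"] fg[of x] fg[of y] rng[of x] rng[of y] b xy
        by auto
      then show False
        using xy(4) b by auto
    qed
    then obtain m c where mc: "\<forall>t\<in>{g x..g y}. f t = m * t + c"
      using B(2)[of "g x" "g y"] lt rng[of x] rng[of y] xy by auto
    have "m \<noteq> 0"
      using mc lt mono[of "g x" "g y"] rng[of x] rng[of y] xy by auto
    have "restrict g {0..1} t = (1 / m) * t + (- c / m)" if t: "t \<in> {x..y}" for t
    proof -
      have "g t \<in> {g x..g y}"
        using gmono[of x t] gmono[of t y] t xy by (cases "t = x"; cases "t = y") auto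
      then have "t = m * g t + c"
        using mc fg[of t] t xy by auto
      then have "g t = (1 / m) * t + (- c / m)"
        using \<open>m \<noteq> 0\<close> by (simp add: field_simps)
      then show ?thesis
        using t xy by simp
    qed
    then show ?thesis
      by blast
  qed
  then show "piecewise_linear (restrict g {0..1})"
    unfolding piecewise_linear_def using B(1) by (intro exI[of _ "f ` B"]) blast
qed

lemma group_PL_plus: "group PL_plus"
proof (rule groupI)
  fix f g assume f: "f \<in> carrier PL_plus" and g: "g \<in> carrier PL_plus"
  obtain f' g' where h: "homeomorphism {0..1} {0..1} f f'" "homeomorphism {0..1} {0..1} g g'"
    using f g by (auto simp: PL_plus_def)
  have im: "f ` {0..1} = {0..1}"
    using h(1) by (simp add: homeomorphism_def)
  have "homeomorphism {0..1} {0..1} (compose {0..1} g f) (f' \<circ> g')"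
    by (rule homeomorphism_cong[OF homeomorphism_compose[OF h]]) (auto simp: compose_def)
  moreover have "strict_mono_on {0..1} (compose {0..1} g f)"
  proof (rule strict_mono_onI)
    fix x y :: real assume xy: "x \<in> {0..1}" "y \<in> {0..1}" "x < y"
    then have "f x < f y" "f x \<in> {0..1}" "f y \<in> {0..1}"
      using strict_mono_onD[of "{0..1}" f x y] f im by (auto simp: PL_plus_def)
    then show "compose {0..1} g f x < compose {0..1} g f y"
      using strict_mono_onD[of "{0..1}" g "f x" "f y"] g xy by (simp add: PL_plus_def compose_def)
  qed
  moreover have "piecewise_linear (compose {0..1} g f)"
    using piecewise_linear_compose[OF _ im] f g by (auto simp: PL_plus_def)
  ultimately show "f \<otimes>\<^bsub>PL_plus\<^esub> g \<in> carrier PL_plus"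
    by (auto simp: PL_plus_def)
next
  have "homeomorphism {0..1} {0..1} (\<lambda>x\<in>{0..1::real}. x) (\<lambda>x. x)"
    by (rule homeomorphism_cong[OF homeomorphism_ident]) auto
  moreover have "piecewise_linear (\<lambda>x\<in>{0..1}. x)"
    unfolding piecewise_linear_def
    by (intro exI[of _ "{}"] conjI allI impI exI[of _ 1] exI[of _ 0]) auto
  ultimately show "\<one>\<^bsub>PL_plus\<^esub> \<in> carrier PL_plus"
    by (auto simp: PL_plus_def strict_mono_on_def)
next
  fix f g h assume "f \<in> carrier PL_plus" "g \<in> carrier PL_plus" "h \<in> carrier PL_plus"
  then show "f \<otimes>\<^bsub>PL_plus\<^esub> g \<otimes>\<^bsub>PL_plus\<^esub> h = f \<otimes>\<^bsub>PL_plus\<^esub> (g \<otimes>\<^bsub>PL_plus\<^esub> h)"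
    by (auto simp: PL_plus_def compose_def homeomorphism_def fun_eq_iff)
next
  fix f assume "f \<in> carrier PL_plus"
  then show "\<one>\<^bsub>PL_plus\<^esub> \<otimes>\<^bsub>PL_plus\<^esub> f = f"
    by (auto simp: PL_plus_def compose_def extensional_def fun_eq_iff)
next
  fix f assume f: "f \<in> carrier PL_plus"
  then obtain g where g: "homeomorphism {0..1} {0..1} f g"
    by (auto simp: PL_plus_def)
  have "homeomorphism {0..1} {0..1} (restrict g {0..1}) f"
    by (rule homeomorphism_cong[OF homeomorphism_symD[OF g]]) auto
  moreover have "strict_mono_on {0..1} g" "piecewise_linear (restrict g {0..1})"
    using piecewise_linear_inverse[OF _ g] f by (auto simp: PL_plus_def)
  ultimately have "restrict g {0..1} \<in> carrier PL_plus"
    by (auto simp: PL_plus_def strict_mono_on_def)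
  moreover have "restrict g {0..1} \<otimes>\<^bsub>PL_plus\<^esub> f = \<one>\<^bsub>PL_plus\<^esub>"
    using g by (auto simp: PL_plus_def compose_def homeomorphism_def fun_eq_iff)
  ultimately show "\<exists>k\<in>carrier PL_plus. k \<otimes>\<^bsub>PL_plus\<^esub> f = \<one>\<^bsub>PL_plus\<^esub>"
    by blast
qed


section \<open>Orbitals and towers\<close>

definition support :: "(real \<Rightarrow> real) \<Rightarrow> real set" where
  "support g = {x \<in> {0..1}. g x \<noteq> x}"

definition orbitals :: "(real \<Rightarrow> real) \<Rightarrow> real set set" where
  "orbitals g = components (support g)"

definition signed_orbitals :: "(real set \<times> (real \<Rightarrow> real)) set" where
  "signed_orbitals = {(A, g). g \<in> carrier PL_plus \<and> A \<in> orbitals g}"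

definition tower :: "(real set \<times> (real \<Rightarrow> real)) set \<Rightarrow> bool" where
  "tower T \<longleftrightarrow> T \<subseteq> signed_orbitals \<and>
     (\<forall>A g B h. (A, g) \<in> T \<longrightarrow> (B, h) \<in> T \<longrightarrow>
        (A \<subseteq> B \<or> B \<subseteq> A) \<and> (A = B \<longrightarrow> g = h))"

definition height :: "(real set \<times> (real \<Rightarrow> real)) set \<Rightarrow> nat" where
  "height T = card T"


section \<open>One-bump functions with fundamental domains\<close>

definition transition_chain :: "(real \<Rightarrow> real) \<Rightarrow> (real \<Rightarrow> real) \<Rightarrow> bool" where
  "transition_chain g h \<longleftrightarrow>
     (\<exists>a b c d. a < c \<and> c < b \<and> b < d \<and> {a<..<b} \<in> orbitals g \<and> {c<..<d} \<in> orbitals h)"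

definition one_sided_overlap :: "(real \<Rightarrow> real) \<Rightarrow> (real \<Rightarrow> real) \<Rightarrow> bool" where
  "one_sided_overlap g h \<longleftrightarrow>
     (\<exists>a b c. a < c \<and> c < b \<and> {a<..<b} \<in> orbitals g \<and>
        ({a<..<c} \<in> orbitals h \<or> {c<..<b} \<in> orbitals h))"

text \<open>The orbital \<open>A\<^sub>h\<close> of a one-bump function \<open>h\<close>.\<close>

definition bump :: "(real \<Rightarrow> real) \<Rightarrow> real set" where
  "bump h = (THE A. A \<in> orbitals h)"

text \<open>
  In the last clause \<open>(r, r\<cdot>h)\<close> is an ordinary open interval, hence empty if \<open>r\<cdot>h \<le> r\<close>:
  an \<open>h\<close> whose orbital properly contains that of another element moves points to the right.
\<close>

definition one_bump_with_fundamental_domains :: "(real \<Rightarrow> real) set \<Rightarrow> bool" where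
  "one_bump_with_fundamental_domains X \<longleftrightarrow>
     X \<subseteq> carrier PL_plus \<and>
     (\<forall>h\<in>X. \<exists>!A. A \<in> orbitals h) \<and>
     (\<forall>g\<in>X. \<forall>h\<in>X. \<not> transition_chain g h \<and> \<not> one_sided_overlap g h) \<and>
     (\<forall>h\<in>X. \<forall>h'\<in>X. h \<noteq> h' \<longrightarrow> bump h \<noteq> bump h') \<and>
     (\<forall>h\<in>X. \<exists>r\<in>bump h. \<forall>h'\<in>X. bump h' \<subset> bump h \<longrightarrow> bump h' \<subseteq> {r<..<h r})"

definition signed_orbitals_of :: "(real \<Rightarrow> real) set \<Rightarrow> (real set \<times> (real \<Rightarrow> real)) set" where
  "signed_orbitals_of Z = {(bump h, h) | h. h \<in> Z}"


section \<open>Derived length\<close>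

text \<open>Only meaningful for soluble groups; for these the derived series reaches the trivial group.\<close>

definition derived_length :: "('a, 'b) monoid_scheme \<Rightarrow> nat" where
  "derived_length G = (LEAST n. (derived G ^^ n) (carrier G) = {\<one>\<^bsub>G\<^esub>})"

end

theory Submission
  imports Defs
begin

text \<open>
  The supports of the elements of \<open>Z\<close> form a finite forest under inclusion, and a tower in the set of
  signed orbitals is a chain in this forest.

  Upper bound. Let \<open>h\<close> run over the roots and let \<open>L h\<close> be generated by the elements strictly below
  \<open>h\<close>. The conjugates of \<open>L h\<close> by different powers of \<open>h\<close> are supported in disjoint translates of a
  fundamental domain, so all these conjugates commute with each other. They generate a normal subgroup
  with abelian quotient; hence passing to the derived subgroup lowers the height of the forest by one.

  Lower bound. Let \<open>h\<close> be the top element of a chain and \<open>D\<close> the fundamental domain of \<open>h\<close> that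
  contains the smaller supports. For \<open>x\<close> in the group generated by the rest of the chain, the
  commutator of \<open>x\<close> and \<open>h\<close> acts on \<open>D\<close> like \<open>x\<close>. So the derived subgroup of the whole chain group
  induces on \<open>D\<close> at least the group of the shorter chain.
\<close>

section \<open>Commutators in generated subgroups\<close>

lemma (in group) exp_derived_incl:
  assumes "subgroup H G"
  shows "(derived G ^^ n) H \<subseteq> H"
proof (induction n)
  case (Suc n)
  then show ?case
    using derived_incl[OF _ assms] by simp
qed simp

text \<open>A subgroup taken as a group in its own right has the derived series that it has in the
  ambient group. This allows every computation to take place in one fixed group.\<close>

lemma (in group) exp_derived_consistent:
  assumes "subgroup H G"
  shows "(derived (G\<lparr>carrier := H\<rparr>) ^^ n) H = (derived G ^^ n) H"
proof (induction n)
  case (Suc n)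
  then show ?case
    using derived_consistent[OF exp_derived_incl[OF assms] assms] by simp
qed simp

lemma (in group) exp_derived_trivial_mono:
  assumes "subgroup H G" "(derived G ^^ k) H = {\<one>}" "k \<le> n"
  shows "(derived G ^^ n) H = {\<one>}"
  using assms(3)
proof (induction rule: dec_induct)
  case (step m)
  then show ?case
    using derived_incl[OF subset_refl triv_subgroup] derived_is_subgroup[of "{\<one>}"] subgroup.one_closed
    by force
qed (rule assms(2))

section \<open>Conjugation and generated subgroups\<close>

lemma (in group) conj_mult:
  assumes "g \<in> carrier G" "x \<in> carrier G" "y \<in> carrier G"
  shows "g \<otimes> (x \<otimes> y) \<otimes> inv g = (g \<otimes> x \<otimes> inv g) \<otimes> (g \<otimes> y \<otimes> inv g)"
  using assms by (metis inv_closed inv_solve_left m_assoc m_closed)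

lemma (in group) conj_inv:
  assumes "g \<in> carrier G" "x \<in> carrier G"
  shows "inv (g \<otimes> x \<otimes> inv g) = g \<otimes> inv x \<otimes> inv g"
  using assms by (simp add: inv_mult_group m_assoc)

lemma (in group) conj_conj:
  assumes "g \<in> carrier G" "h \<in> carrier G" "x \<in> carrier G"
  shows "g \<otimes> (h \<otimes> x \<otimes> inv h) \<otimes> inv g = (g \<otimes> h) \<otimes> x \<otimes> inv (g \<otimes> h)"
  using assms by (simp add: inv_mult_group m_assoc)

lemma (in group) conj_eq_if_commute:
  assumes "g \<in> carrier G" "x \<in> carrier G" "g \<otimes> x = x \<otimes> g"
  shows "g \<otimes> x \<otimes> inv g = x"
  using assms by (simp add: m_assoc)

lemma (in group) group_hom_conj:
  assumes "g \<in> carrier G"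
  shows "group_hom G G (\<lambda>x. g \<otimes> x \<otimes> inv g)"
  by unfold_locales (use assms in \<open>auto simp: hom_def conj_mult\<close>)

lemma (in group) conj_in_generate:
  assumes "A \<subseteq> carrier G" "g \<in> carrier G"
    and "\<And>a. a \<in> A \<Longrightarrow> g \<otimes> a \<otimes> inv g \<in> generate G A"
    and "x \<in> generate G A"
  shows "g \<otimes> x \<otimes> inv g \<in> generate G A"
  using assms(4)
proof (induction rule: generate.induct)
  case one
  then show ?case using assms by (simp add: generate.one)
next
  case (incl h)
  then show ?case using assms by auto
next
  case (inv h)
  then have "h \<in> carrier G"
    using assms by auto
  then have "g \<otimes> inv h \<otimes> inv g = inv (g \<otimes> h \<otimes> inv g)"
    using assms by (simp add: conj_inv)
  then show ?case
    using generate_m_inv_closed[OF assms(1) assms(3)[OF inv]] by simp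
next
  case (eng h k)
  then have "h \<in> carrier G" "k \<in> carrier G"
    using assms(1) generate_in_carrier by auto
  then show ?case
    using generate.eng[OF eng.IH] by (simp add: conj_mult assms)
qed

lemma (in group) generate_normalizes:
  assumes S: "S \<subseteq> carrier G" and N: "N \<subseteq> carrier G"
    and conj: "\<And>s x. s \<in> S \<Longrightarrow> x \<in> N \<Longrightarrow> s \<otimes> x \<otimes> inv s \<in> N \<and> inv s \<otimes> x \<otimes> s \<in> N"
    and "g \<in> generate G S" "x \<in> N"
  shows "g \<otimes> x \<otimes> inv g \<in> N"
  using assms(4,5)
proof (induction arbitrary: x rule: generate.induct)
  case one
  then show ?case using N by auto
next
  case (incl h)
  then show ?case using conj by auto
next
  case (inv h)
  then show ?case using conj[of h x] S by auto
next
  case (eng h k)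
  then have "h \<in> carrier G" "k \<in> carrier G" "x \<in> carrier G"
    using S N generate_in_carrier by auto
  then show ?case
    using eng.IH eng.prems by (metis conj_conj)
qed

text \<open>With [x, y] = x y x^-1 y^-1, induction over words works because [h k, y] = (h [k, y]
  h^-1) [h, y] and [h^-1, y] = h^-1 [h, y]^-1 h. Normality of \<open>N\<close> absorbs the
  conjugations.\<close>

lemma (in group) commutator_in_generate_left:
  assumes S: "S \<subseteq> carrier G" and N: "subgroup N G"
    and norm: "\<And>g x. g \<in> generate G S \<Longrightarrow> x \<in> N \<Longrightarrow> g \<otimes> x \<otimes> inv g \<in> N"
    and y: "y \<in> carrier G"
    and comm: "\<And>s. s \<in> S \<Longrightarrow> s \<otimes> y \<otimes> inv s \<otimes> inv y \<in> N"
    and "x \<in> generate G S"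
  shows "x \<otimes> y \<otimes> inv x \<otimes> inv y \<in> N"
  using assms(6)
proof (induction rule: generate.induct)
  case one
  then show ?case using y subgroup.one_closed[OF N] by simp
next
  case (incl h)
  then show ?case using comm by auto
next
  case (inv h)
  then have h: "h \<in> carrier G" using S by auto
  have "inv h \<otimes> inv (h \<otimes> y \<otimes> inv h \<otimes> inv y) \<otimes> inv (inv h) \<in> N"
    by (intro norm generate.inv[OF inv] subgroup.m_inv_closed[OF N] comm[OF inv])
  moreover have "inv h \<otimes> inv (h \<otimes> y \<otimes> inv h \<otimes> inv y) \<otimes> inv (inv h) = inv h \<otimes> y \<otimes> inv (inv h) \<otimes> inv y"
    using h y by (simp add: inv_mult_group m_assoc inv_solve_left)
  ultimately show ?case by simp
next
  case (eng h k)
  then have hk: "h \<in> carrier G" "k \<in> carrier G"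
    using S generate_in_carrier by auto
  have "(h \<otimes> (k \<otimes> y \<otimes> inv k \<otimes> inv y) \<otimes> inv h) \<otimes> (h \<otimes> y \<otimes> inv h \<otimes> inv y) \<in> N"
    by (intro subgroup.m_closed[OF N] norm eng)
  moreover have "(h \<otimes> (k \<otimes> y \<otimes> inv k \<otimes> inv y) \<otimes> inv h) \<otimes> (h \<otimes> y \<otimes> inv h \<otimes> inv y) =
      h \<otimes> k \<otimes> y \<otimes> inv (h \<otimes> k) \<otimes> inv y"
    using hk y by (simp add: inv_mult_group m_assoc) (simp add: m_assoc[symmetric])
  ultimately show ?case by simp
qed

text \<open>A normal subgroup modulo which the generators commute contains the derived subgroup. The
  commutator condition is extended to words in the first argument, then, inverting with
  \<open>flip\<close>, to words in the second. Conjugation is assumed in both directions because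
  generated words contain inverses of generators.\<close>

lemma (in group) derived_generate_subset:
  assumes S: "S \<subseteq> carrier G" and N: "subgroup N G"
    and conj: "\<And>s x. s \<in> S \<Longrightarrow> x \<in> N \<Longrightarrow> s \<otimes> x \<otimes> inv s \<in> N \<and> inv s \<otimes> x \<otimes> s \<in> N"
    and comm: "\<And>s t. s \<in> S \<Longrightarrow> t \<in> S \<Longrightarrow> s \<otimes> t \<otimes> inv s \<otimes> inv t \<in> N"
  shows "derived G (generate G S) \<subseteq> N"
proof -
  note norm = generate_normalizes[OF S subgroup.subset[OF N] conj]
  have flip: "inv (x \<otimes> y \<otimes> inv x \<otimes> inv y) = y \<otimes> x \<otimes> inv y \<otimes> inv x"
    if "x \<in> carrier G" "y \<in> carrier G" for x y
    using that by (simp add: inv_mult_group m_assoc)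
  have 1: "x \<otimes> t \<otimes> inv x \<otimes> inv t \<in> N" if "x \<in> generate G S" "t \<in> S" for x t
    using commutator_in_generate_left[OF S N norm _ comm] that S by blast
  have 2: "x \<otimes> y \<otimes> inv x \<otimes> inv y \<in> N" if "x \<in> generate G S" "y \<in> generate G S" for x y
  proof (rule commutator_in_generate_left[OF S N norm])
    show "y \<in> carrier G" using that S generate_in_carrier by blast
    then show "s \<otimes> y \<otimes> inv s \<otimes> inv y \<in> N" if "s \<in> S" for s
      using subgroup.m_inv_closed[OF N 1[of y s]] flip[of y s] that \<open>y \<in> generate G S\<close> S by auto
  qed (use that in auto)
  show ?thesis
    unfolding derived_def by (rule generate_subgroup_incl[OF _ N]) (use 2 in auto)
qed

text \<open>Commutators between different factors vanish and those within one factor lie in its own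
  derived subgroup. The derived subgroups together are normalized by every factor, so testing on
  generators suffices. The index set may be infinite.\<close>

lemma (in group) derived_generate_UN_commuting:
  assumes K: "\<And>i. i \<in> I \<Longrightarrow> subgroup (K i) G"
    and comm: "\<And>i j x y. i \<in> I \<Longrightarrow> j \<in> I \<Longrightarrow> i \<noteq> j \<Longrightarrow> x \<in> K i \<Longrightarrow> y \<in> K j \<Longrightarrow> x \<otimes> y = y \<otimes> x"
  shows "derived G (generate G (\<Union>i\<in>I. K i)) \<subseteq> generate G (\<Union>i\<in>I. derived G (K i))"
proof (rule derived_generate_subset)
  let ?T = "\<Union>i\<in>I. derived G (K i)"
  have KG: "x \<in> carrier G" if "i \<in> I" "x \<in> K i" for i x
    using subgroup.mem_carrier[OF K] that by auto
  have dK: "derived G (K i) \<subseteq> K i" if "i \<in> I" for i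
    using derived_incl[OF subset_refl K] that by auto
  then have T: "?T \<subseteq> carrier G" using KG by blast
  show "(\<Union>i\<in>I. K i) \<subseteq> carrier G" using KG by blast
  show "subgroup (generate G ?T) G" by (rule generate_is_subgroup[OF T])
  have comm_derived: "s \<otimes> t \<otimes> inv s \<otimes> inv t \<in> derived G (K i)" if "i \<in> I" "s \<in> K i" "t \<in> K i" for i s t
    unfolding derived_def by (rule generate.incl) (use that in auto)
  have conj: "s \<otimes> t \<otimes> inv s \<in> generate G ?T" if ij: "i \<in> I" "s \<in> K i" "j \<in> I" "t \<in> derived G (K j)" for s t i j
  proof (cases "i = j")
    case True
    have t: "t \<in> K i" using dK ij True by auto
    \<comment> \<open>The conjugate of \<open>t\<close> by \<open>s\<close> is [s, t] t, a product
      of two elements of the derived subgroup.\<close>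
    then have "(s \<otimes> t \<otimes> inv s \<otimes> inv t) \<otimes> t \<in> derived G (K i)"
      using subgroup.m_closed[OF derived_is_subgroup[OF subgroup.subset[OF K[OF ij(1)]]] comm_derived[OF ij(1,2) t]]
        ij True by blast
    then have "s \<otimes> t \<otimes> inv s \<in> derived G (K i)"
      using KG[of i s] KG[of i t] t ij by (simp add: m_assoc)
    then show ?thesis using ij by (blast intro: generate.incl)
  next
    case False
    have "t \<in> K j" using dK ij by auto
    then have "s \<otimes> t \<otimes> inv s = t"
      using False comm ij KG by (intro conj_eq_if_commute) auto
    then show ?thesis using ij by (auto intro: generate.incl)
  qed
  fix s assume "s \<in> (\<Union>i\<in>I. K i)"
  then obtain i where i: "i \<in> I" "s \<in> K i" by auto
  then have s: "s \<in> carrier G" using KG by auto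
  {
    fix x assume x: "x \<in> generate G ?T"
    have "s \<otimes> x \<otimes> inv s \<in> generate G ?T"
      by (rule conj_in_generate[OF T s _ x]) (use conj i in auto)
    moreover have "inv s \<otimes> x \<otimes> inv (inv s) \<in> generate G ?T"
    proof (rule conj_in_generate[OF T _ _ x])
      show "inv s \<otimes> a \<otimes> inv (inv s) \<in> generate G ?T" if "a \<in> ?T" for a
        using conj[OF i(1) subgroup.m_inv_closed[OF K[OF i(1)] i(2)]] that by blast
    qed (use s in auto)
    ultimately show "s \<otimes> x \<otimes> inv s \<in> generate G ?T \<and> inv s \<otimes> x \<otimes> s \<in> generate G ?T"
      using s by simp
  next
    fix t assume "t \<in> (\<Union>i\<in>I. K i)"
    then obtain j where j: "j \<in> I" "t \<in> K j" by auto
    then have t: "t \<in> carrier G" using KG by auto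
    show "s \<otimes> t \<otimes> inv s \<otimes> inv t \<in> generate G ?T"
    proof (cases "i = j")
      case True
      then show ?thesis using comm_derived i j by (blast intro: generate.incl)
    next
      case False
      then have "s \<otimes> t \<otimes> inv s = t"
        using comm i j s t by (intro conj_eq_if_commute) auto
      then show ?thesis using t by (simp add: generate.one)
    qed
  }
qed

text \<open>The preceding bound iterates because the derived subgroups of commuting factors are
  again commuting subgroups.\<close>

lemma (in group) exp_derived_generate_UN_commuting:
  assumes K: "\<And>i. i \<in> I \<Longrightarrow> subgroup (K i) G"
    and comm: "\<And>i j x y. i \<in> I \<Longrightarrow> j \<in> I \<Longrightarrow> i \<noteq> j \<Longrightarrow> x \<in> K i \<Longrightarrow> y \<in> K j \<Longrightarrow> x \<otimes> y = y \<otimes> x"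
  shows "(derived G ^^ n) (generate G (\<Union>i\<in>I. K i)) \<subseteq> generate G (\<Union>i\<in>I. (derived G ^^ n) (K i))"
proof (induction n)
  case (Suc n)
  have sub: "(derived G ^^ n) (K i) \<subseteq> K i" if "i \<in> I" for i
    by (rule exp_derived_incl[OF K[OF that]])
  have "(derived G ^^ Suc n) (generate G (\<Union>i\<in>I. K i)) \<subseteq> derived G (generate G (\<Union>i\<in>I. (derived G ^^ n) (K i)))"
    using mono_derived[OF Suc] by simp
  also have "\<dots> \<subseteq> generate G (\<Union>i\<in>I. derived G ((derived G ^^ n) (K i)))"
    by (rule derived_generate_UN_commuting)
      (use exp_of_derived_is_subgroup[OF K] comm sub in blast)+
  finally show ?case by simp
qed simp

section \<open>Supports\<close>

interpretation PL: group PL_plus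
  by (rule group_PL_plus)

lemma PL_plus_mult_apply:
  "x \<in> {0..1} \<Longrightarrow> (f \<otimes>\<^bsub>PL_plus\<^esub> g) x = g (f x)"
  by (simp add: PL_plus_def compose_def)

lemma PL_plus_one_apply: "x \<in> {0..1} \<Longrightarrow> \<one>\<^bsub>PL_plus\<^esub> x = x"
  by (simp add: PL_plus_def)

lemma PL_plus_bij_betw: "f \<in> carrier PL_plus \<Longrightarrow> bij_betw f {0..1} {0..1}"
  by (auto simp: PL_plus_def bij_betw_def strict_mono_on_imp_inj_on dest: homeomorphism_image1)

lemma PL_plus_closed: "f \<in> carrier PL_plus \<Longrightarrow> x \<in> {0..1} \<Longrightarrow> f x \<in> {0..1}"
  using PL_plus_bij_betw bij_betwE by blast

lemma PL_plus_less_iff: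
  "f \<in> carrier PL_plus \<Longrightarrow> x \<in> {0..1} \<Longrightarrow> y \<in> {0..1} \<Longrightarrow> f x < f y \<longleftrightarrow> x < y"
  using strict_mono_on_less[of "{0..1}" f x y] by (simp add: PL_plus_def)

lemma PL_plus_le_iff:
  "f \<in> carrier PL_plus \<Longrightarrow> x \<in> {0..1} \<Longrightarrow> y \<in> {0..1} \<Longrightarrow> f x \<le> f y \<longleftrightarrow> x \<le> y"
  using PL_plus_less_iff[of f y x] by (meson not_le)

lemma PL_plus_eq_iff:
  "f \<in> carrier PL_plus \<Longrightarrow> x \<in> {0..1} \<Longrightarrow> y \<in> {0..1} \<Longrightarrow> f x = f y \<longleftrightarrow> x = y"
  using PL_plus_le_iff[of f x y] PL_plus_le_iff[of f y x] by (metis order.antisym order.refl)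

lemma PL_plus_eqI:
  assumes "f \<in> carrier PL_plus" "g \<in> carrier PL_plus" "\<And>x. x \<in> {0..1} \<Longrightarrow> f x = g x"
  shows "f = g"
  using assms by (auto simp: PL_plus_def intro: extensionalityI)

lemma PL_plus_inv_apply:
  assumes "f \<in> carrier PL_plus" "x \<in> {0..1}"
  shows "f ((inv\<^bsub>PL_plus\<^esub> f) x) = x" "(inv\<^bsub>PL_plus\<^esub> f) (f x) = x"
  using assms PL.l_inv[of f] PL.r_inv[of f]
  by (metis PL_plus_mult_apply PL_plus_one_apply)+

lemma PL_plus_endpoints:
  assumes "f \<in> carrier PL_plus"
  shows "f 0 = 0" "f 1 = 1"
proof -
  have "0 \<in> f ` {0..1}" "1 \<in> f ` {0..1}"
    using PL_plus_bij_betw[OF assms] by (simp_all add: bij_betw_def)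
  then obtain x y where "x \<in> {0..1}" "f x = 0" "y \<in> {0..1}" "f y = 1"
    by (metis imageE)
  then show "f 0 = 0" "f 1 = 1"
    using PL_plus_le_iff[OF assms, of 0 x] PL_plus_le_iff[OF assms, of y 1]
      PL_plus_closed[OF assms, of 0] PL_plus_closed[OF assms, of 1] by auto
qed

lemma PL_plus_continuous: "f \<in> carrier PL_plus \<Longrightarrow> continuous_on {0..1} f"
  by (auto simp: PL_plus_def homeomorphism_def)

section \<open>Supports under the group operations\<close>

lemma not_in_support: "x \<in> {0..1} \<Longrightarrow> x \<notin> support f \<longleftrightarrow> f x = x"
  by (simp add: support_def)

lemma support_subset: "support f \<subseteq> {0..1}"
  by (auto simp: support_def)

lemma support_eq_empty_iff:
  assumes "f \<in> carrier PL_plus"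
  shows "support f = {} \<longleftrightarrow> f = \<one>\<^bsub>PL_plus\<^esub>"
proof
  assume "support f = {}"
  then show "f = \<one>\<^bsub>PL_plus\<^esub>"
    using assms by (intro PL_plus_eqI) (auto simp: PL_plus_one_apply support_def)
qed (auto simp: support_def PL_plus_one_apply)

text \<open>Both endpoints are fixed, so the support lies in the open unit interval and is open in
  the real line, not merely in the closed interval.\<close>

lemma open_support:
  assumes "f \<in> carrier PL_plus"
  shows "open (support f)"
proof -
  have "support f = {0<..<1} \<inter> (\<lambda>x. f x - x) -` (- {0})"
    using PL_plus_endpoints[OF assms]
    by (auto simp: support_def less_le)
  moreover have "open ({0<..<1} \<inter> (\<lambda>x. f x - x) -` (- {0}))"
    by (intro continuous_open_preimage continuous_intros)
      (auto intro: continuous_on_subset[OF PL_plus_continuous[OF assms]])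
  ultimately show ?thesis by simp
qed

lemma support_inv:
  assumes "f \<in> carrier PL_plus"
  shows "support (inv\<^bsub>PL_plus\<^esub> f) = support f"
proof -
  have "(inv\<^bsub>PL_plus\<^esub> f) x = x \<longleftrightarrow> f x = x" if "x \<in> {0..1}" for x
    using PL_plus_inv_apply[OF assms that] by auto
  then show ?thesis by (auto simp: support_def)
qed

text \<open>A point sent outside \<open>D\<close> would have a fixed image and hence, by
  injectivity, be fixed itself. Surjectivity onto \<open>D\<close> follows from the same argument
  for the inverse.\<close>

lemma support_image:
  assumes f: "f \<in> carrier PL_plus" and D: "support f \<subseteq> D" "D \<subseteq> {0..1}"
  shows "f ` D = D"
proof -
  have *: "f x \<in> D" if f: "f \<in> carrier PL_plus" "support f \<subseteq> D" and x: "x \<in> D" for f x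
  proof (rule ccontr)
    assume "f x \<notin> D"
    moreover have "x \<in> {0..1}" "f x \<in> {0..1}"
      using x D PL_plus_closed f by blast+
    ultimately have "f (f x) = f x" using not_in_support f by blast
    then have "f x = x"
      using PL_plus_eq_iff f \<open>x \<in> {0..1}\<close> \<open>f x \<in> {0..1}\<close> by blast
    then show False using \<open>f x \<notin> D\<close> x by simp
  qed
  have "(inv\<^bsub>PL_plus\<^esub> f) x \<in> D" if "x \<in> D" for x
    using *[of "inv\<^bsub>PL_plus\<^esub> f"] f D that by (simp add: support_inv)
  moreover have "f ((inv\<^bsub>PL_plus\<^esub> f) x) = x" if "x \<in> D" for x
    using PL_plus_inv_apply(1)[OF f, of x] D that by blast
  ultimately show ?thesis
    using *[OF f D(1)] by (intro subset_antisym subsetI) (auto, metis image_eqI)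
qed

lemma subgroup_support_subset:
  "subgroup {f \<in> carrier PL_plus. support f \<subseteq> D} PL_plus"
proof (rule subgroup.intro)
  fix f g assume *: "f \<in> {f \<in> carrier PL_plus. support f \<subseteq> D}" "g \<in> {f \<in> carrier PL_plus. support f \<subseteq> D}"
  then have "(f \<otimes>\<^bsub>PL_plus\<^esub> g) x = x" if "x \<in> {0..1} - D" for x
    using not_in_support[of x f] not_in_support[of x g] that by (auto simp: PL_plus_mult_apply)
  then show "f \<otimes>\<^bsub>PL_plus\<^esub> g \<in> {f \<in> carrier PL_plus. support f \<subseteq> D}"
    using * by (auto simp: support_def)
next
  fix f assume "f \<in> {f \<in> carrier PL_plus. support f \<subseteq> D}"
  then show "inv\<^bsub>PL_plus\<^esub> f \<in> {f \<in> carrier PL_plus. support f \<subseteq> D}"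
    by (simp add: support_inv)
qed (auto simp: support_def PL_plus_one_apply)

lemma support_generate_subset:
  assumes "X \<subseteq> carrier PL_plus" "\<And>f. f \<in> X \<Longrightarrow> support f \<subseteq> D" "f \<in> generate PL_plus X"
  shows "support f \<subseteq> D"
  using PL.generate_subgroup_incl[OF _ subgroup_support_subset, of X D] assms by auto

text \<open>Since the leftmost factor acts first, this conjugate moves \<open>x\<close> exactly when
  \<open>f\<close> moves \<open>g x\<close>: the support is pulled back along
  \<open>g\<close>.\<close>

lemma support_conj:
  assumes "f \<in> carrier PL_plus" "g \<in> carrier PL_plus"
  shows "support (g \<otimes>\<^bsub>PL_plus\<^esub> f \<otimes>\<^bsub>PL_plus\<^esub> inv\<^bsub>PL_plus\<^esub> g) = {x \<in> {0..1}. g x \<in> support f}"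
proof -
  let ?c = "g \<otimes>\<^bsub>PL_plus\<^esub> f \<otimes>\<^bsub>PL_plus\<^esub> inv\<^bsub>PL_plus\<^esub> g"
  have "?c x = x \<longleftrightarrow> f (g x) = g x" if x: "x \<in> {0..1}" for x
  proof -
    have gx: "g x \<in> {0..1}" by (rule PL_plus_closed[OF assms(2) x])
    have "?c x = (inv\<^bsub>PL_plus\<^esub> g) (f (g x))" using x by (simp add: PL_plus_mult_apply)
    also have "\<dots> = x \<longleftrightarrow> f (g x) = g x"
      using PL_plus_inv_apply(1)[OF assms(2) PL_plus_closed[OF assms(1) gx]] PL_plus_inv_apply(2)[OF assms(2) x]
      by metis
    finally show ?thesis .
  qed
  moreover have "x \<in> {0..1} \<Longrightarrow> g x \<in> {0..1}" for x by (rule PL_plus_closed[OF assms(2)])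
  ultimately show ?thesis unfolding support_def by blast
qed

lemma disjoint_support_commute:
  assumes f: "f \<in> carrier PL_plus" and g: "g \<in> carrier PL_plus" and "support f \<inter> support g = {}"
  shows "f \<otimes>\<^bsub>PL_plus\<^esub> g = g \<otimes>\<^bsub>PL_plus\<^esub> f"
proof (rule PL_plus_eqI)
  fix x :: real assume x: "x \<in> {0..1}"
  \<comment> \<open>On the support of \<open>f\<close> both \<open>x\<close> and \<open>f x\<close>
    are fixed by \<open>g\<close>, because \<open>f\<close> maps its support to itself.\<close>
  have *: "g (f x) = f (g x)"
    if f: "f \<in> carrier PL_plus" and d: "support f \<inter> support g = {}" and xf: "x \<in> support f" for f g
  proof -
    have "f x \<in> support f"
      using support_image[OF f order.refl support_subset] xf by blast
    then have "x \<in> {0..1}" "f x \<in> {0..1}" "x \<notin> support g" "f x \<notin> support g"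
      using d xf support_subset[of f] by blast+
    then show ?thesis by (simp add: not_in_support)
  qed
  have "g (f x) = f (g x)"
  proof (cases "x \<in> support f \<or> x \<in> support g")
    case True
    then show ?thesis
      using *[OF f assms(3)] *[OF g, of f] assms(3) by (auto simp: Int_commute)
  next
    case False
    then show ?thesis using x by (simp add: not_in_support)
  qed
  then show "(f \<otimes>\<^bsub>PL_plus\<^esub> g) x = (g \<otimes>\<^bsub>PL_plus\<^esub> f) x"
    using x by (simp add: PL_plus_mult_apply)
qed (use f g in auto)

section \<open>Supports of one-bump functions as open intervals\<close>

lemma open_connected_bounded_real:
  fixes S :: "real set"
  assumes "open S" "connected S" "bounded S" "S \<noteq> {}"
  obtains a b where "S = {a<..<b}" "a < b"
proof -
  have bdd: "bdd_above S" "bdd_below S"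
    using bounded_imp_bdd_above bounded_imp_bdd_below assms by auto
  have "S = {Inf S<..<Sup S}"
  proof (intro Set.set_eqI iffI)
    fix x assume x: "x \<in> S"
    then obtain e where e: "e > 0" "ball x e \<subseteq> S"
      using assms(1) open_contains_ball by blast
    then have "x - e/2 \<in> S" "x + e/2 \<in> S"
      by (auto simp: subset_iff dist_real_def)
    then have "Inf S \<le> x - e/2" "x + e/2 \<le> Sup S"
      using bdd by (auto intro: cInf_lower cSup_upper)
    then show "x \<in> {Inf S<..<Sup S}" using e by auto
  next
    fix x assume "x \<in> {Inf S<..<Sup S}"
    then obtain y z where "y \<in> S" "y < x" "z \<in> S" "x < z"
      using assms(4) bdd by (auto simp: cInf_less_iff less_cSup_iff)
    then show "x \<in> S"
      using assms(2) connected_contains_Icc[of S y z] by auto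
  qed
  then show ?thesis
    using that assms(4) by (metis greaterThanLessThan_empty_iff not_le)
qed

text \<open>The support is the union of its components, and here there is only one.\<close>

lemma bump_eq_support:
  assumes "f \<in> carrier PL_plus" "\<exists>!A. A \<in> orbitals f"
  shows "bump f = support f" "support f \<in> orbitals f"
proof -
  have 1: "bump f \<in> orbitals f"
    unfolding bump_def using assms(2) by (rule theI')
  then have "orbitals f = {bump f}"
    using assms(2) by auto
  moreover have "\<Union>(orbitals f) = support f"
    unfolding orbitals_def by (simp add: Union_components)
  ultimately show 2: "bump f = support f" by auto
  show "support f \<in> orbitals f" using 1 2 by simp
qed

lemma support_interval:
  assumes "f \<in> carrier PL_plus" "support f \<in> orbitals f"
  obtains a b where "support f = {a<..<b}" "a < b"
proof (rule open_connected_bounded_real)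
  show "open (support f)" by (rule open_support[OF assms(1)])
  show "connected (support f)" "support f \<noteq> {}"
    using assms(2) in_components_connected in_components_nonempty unfolding orbitals_def by auto
  show "bounded (support f)"
    using bounded_subset[OF bounded_closed_interval support_subset] by blast
qed (use that in auto)

section \<open>Nested fundamental domains\<close>

text \<open>
  What the argument needs from (Z0)-(Z3). Two intervals that meet without being nested form a
  transition chain, so (Z1) makes the supports a laminar family.
\<close>

definition nested_domains :: "(real \<Rightarrow> real) set \<Rightarrow> bool" where
  "nested_domains X \<longleftrightarrow> X \<subseteq> carrier PL_plus \<and> inj_on support X \<and>
     (\<forall>h\<in>X. support h \<noteq> {}) \<and>
     (\<forall>g\<in>X. \<forall>h\<in>X. support g \<subseteq> support h \<or> support h \<subseteq> support g \<or> support g \<inter> support h = {}) \<and>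
     (\<forall>h\<in>X. \<exists>r\<in>{0..1}. \<forall>g\<in>X. support g \<subset> support h \<longrightarrow> support g \<subseteq> {r<..<h r})"

text \<open>Both inductions pass to a smaller family: the elements below a root, or a chain without
  its top.\<close>

lemma nested_domains_subset: "nested_domains X \<Longrightarrow> Y \<subseteq> X \<Longrightarrow> nested_domains Y"
  unfolding nested_domains_def by (meson inj_on_subset subset_iff)

lemma one_bump_bump_eq:
  assumes "one_bump_with_fundamental_domains X" "h \<in> X"
  shows "h \<in> carrier PL_plus" "bump h = support h" "bump h \<in> orbitals h"
  using bump_eq_support[of h] assms unfolding one_bump_with_fundamental_domains_def by auto

lemma one_bump_imp_nested_domains:
  assumes X: "one_bump_with_fundamental_domains X"
  shows "nested_domains X"
  unfolding nested_domains_def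
proof (intro conjI ballI)
  note bump = one_bump_bump_eq[OF X]
  show "X \<subseteq> carrier PL_plus" using bump by auto
  show "inj_on support X"
    using X bump(2) unfolding one_bump_with_fundamental_domains_def inj_on_def by metis
  fix h assume h: "h \<in> X"
  obtain c d where cd: "support h = {c<..<d}" "c < d"
    using support_interval bump[OF h] by metis
  then show "support h \<noteq> {}" by simp
  show "\<exists>r\<in>{0..1}. \<forall>g\<in>X. support g \<subset> support h \<longrightarrow> support g \<subseteq> {r<..<h r}"
    using X h bump(2) support_subset[of h] unfolding one_bump_with_fundamental_domains_def
    by (metis subset_iff)
  fix g assume g: "g \<in> X"
  obtain a b where ab: "support g = {a<..<b}" "a < b"
    using support_interval bump[OF g] by metis
  \<comment> \<open>With proper overlaps excluded in both orders, comparing endpoints leaves only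
    nesting and disjointness.\<close>
  have "\<not> transition_chain g h" "\<not> transition_chain h g"
    using X g h unfolding one_bump_with_fundamental_domains_def by auto
  moreover have "{a<..<b} \<in> orbitals g" "{c<..<d} \<in> orbitals h"
    using ab cd bump(2,3)[OF g] bump(2,3)[OF h] by auto
  ultimately have "\<not> (a < c \<and> c < b \<and> b < d)" "\<not> (c < a \<and> a < d \<and> d < b)"
    unfolding transition_chain_def by blast+
  then consider "c \<le> a \<and> b \<le> d" | "a \<le> c \<and> d \<le> b" | "b \<le> c" | "d \<le> a"
    by linarith
  then show "support h \<subseteq> support g \<or> support g \<subseteq> support h \<or> support h \<inter> support g = {}"
    by cases (auto simp: ab cd)
qed

text \<open>From \<open>r < y\<close> one application of \<open>h\<close> carries \<open>y\<close>
  beyond \<open>h r\<close>. As \<open>r < h r\<close> implies \<open>h r < h (h r)\<close>, further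
  applications keep it there. The exponent \<open>Suc n\<close> ensures at least one
  application.\<close>

lemma fundamental_domain_pow:
  assumes h: "h \<in> carrier PL_plus" and r: "r \<in> {0..1}" and y: "y \<in> {r<..<h r}"
  shows "h r < (h [^]\<^bsub>PL_plus\<^esub> Suc n) y"
proof (induction n)
  case 0
  have "y \<in> {0..1}" using PL_plus_closed[OF h r] r y by auto
  then show ?case using h r y by (simp add: PL_plus_less_iff)
next
  case (Suc n)
  have y01: "y \<in> {0..1}" using PL_plus_closed[OF h r] r y by auto
  then have p01: "(h [^]\<^bsub>PL_plus\<^esub> Suc n) y \<in> {0..1}"
    using PL_plus_closed h PL.nat_pow_closed by blast
  have "h r < h (h r)"
    using PL_plus_less_iff[OF h r PL_plus_closed[OF h r]] y by auto
  also have "\<dots> < h ((h [^]\<^bsub>PL_plus\<^esub> Suc n) y)"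
    using PL_plus_less_iff[OF h PL_plus_closed[OF h r] p01] Suc by simp
  also have "\<dots> = (h [^]\<^bsub>PL_plus\<^esub> Suc (Suc n)) y"
    using PL_plus_mult_apply[OF y01, of "h [^]\<^bsub>PL_plus\<^esub> Suc n" h] by simp
  finally show ?case .
qed

text \<open>The two images of \<open>x\<close> differ by a positive power of \<open>h\<close>, which
  moves every point of the domain out of it. Through the formula for supports of conjugates, this
  separates conjugates by different powers.\<close>

lemma fundamental_domain_disjoint:
  assumes h: "h \<in> carrier PL_plus" and r: "r \<in> {0..1}" and "i \<noteq> (j::int)" and x: "x \<in> {0..1}"
    and i: "(h [^]\<^bsub>PL_plus\<^esub> i) x \<in> {r<..<h r}" and j: "(h [^]\<^bsub>PL_plus\<^esub> j) x \<in> {r<..<h r}"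
  shows False
proof -
  have *: False if "i < j" and i: "(h [^]\<^bsub>PL_plus\<^esub> i) x \<in> {r<..<h r}"
    and j: "(h [^]\<^bsub>PL_plus\<^esub> j) x \<in> {r<..<h r}" for i j :: int
  proof -
    obtain n where n: "j = i + int (Suc n)"
      using \<open>i < j\<close> by (metis add.commute zless_iff_Suc_zadd)
    have "h [^]\<^bsub>PL_plus\<^esub> j = h [^]\<^bsub>PL_plus\<^esub> i \<otimes>\<^bsub>PL_plus\<^esub> h [^]\<^bsub>PL_plus\<^esub> Suc n"
      unfolding n PL.int_pow_mult[OF h] int_pow_int ..
    then have "(h [^]\<^bsub>PL_plus\<^esub> j) x = (h [^]\<^bsub>PL_plus\<^esub> Suc n) ((h [^]\<^bsub>PL_plus\<^esub> i) x)"
      using x by (simp add: PL_plus_mult_apply del: nat_pow_Suc)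
    then show False
      using fundamental_domain_pow[OF h r i, of n] j by simp
  qed
  show False using *[of i j] *[of j i] assms by linarith
qed

section \<open>Towers as chains of supports\<close>

definition chain_of :: "(real \<Rightarrow> real) set \<Rightarrow> bool" where
  "chain_of C \<longleftrightarrow> (\<forall>g\<in>C. \<forall>h\<in>C. support g \<subseteq> support h \<or> support h \<subseteq> support g)"

text \<open>In a signed orbital of \<open>Z\<close> the orbital is the support of the element, so
  forgetting it loses nothing and preserves cardinality. Conversely, injectivity of
  \<open>support\<close> on \<open>Z\<close> turns a chain into a tower.\<close>

lemma tower_heights_eq_card_chains:
  assumes Z: "one_bump_with_fundamental_domains Z"
  shows "{height T | T. tower T \<and> T \<subseteq> signed_orbitals_of Z} = card ` {C. C \<subseteq> Z \<and> chain_of C}"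
proof (intro subset_antisym subsetI)
  note bump = one_bump_bump_eq[OF Z]
  fix k assume "k \<in> {height T | T. tower T \<and> T \<subseteq> signed_orbitals_of Z}"
  then obtain T where T: "k = card T" "tower T" "T \<subseteq> signed_orbitals_of Z"
    unfolding height_def by auto
  have T_mem: "snd p \<in> Z" "fst p = support (snd p)" if "p \<in> T" for p
    using T(3) that bump unfolding signed_orbitals_of_def by auto
  have "card (snd ` T) = k"
    unfolding T(1) using T_mem(2) by (intro card_image inj_onI prod_eqI) auto
  moreover have "support (snd p) \<subseteq> support (snd q) \<or> support (snd q) \<subseteq> support (snd p)"
    if "p \<in> T" "q \<in> T" for p q
    using T(2) T_mem(2)[OF that(1)] T_mem(2)[OF that(2)] that unfolding tower_def by (metis prod.collapse)
  then have "chain_of (snd ` T)"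
    unfolding chain_of_def by blast
  ultimately show "k \<in> card ` {C. C \<subseteq> Z \<and> chain_of C}"
    using T_mem by (intro image_eqI[of _ _ "snd ` T"]) auto
next
  note bump = one_bump_bump_eq[OF Z]
  fix k assume "k \<in> card ` {C. C \<subseteq> Z \<and> chain_of C}"
  then obtain C where C: "k = card C" "C \<subseteq> Z" "chain_of C" by auto
  let ?T = "(\<lambda>h. (support h, h)) ` C"
  have "inj_on support Z"
    using one_bump_imp_nested_domains[OF Z] unfolding nested_domains_def by blast
  then have "inj_on support C" using C(2) by (rule inj_on_subset)
  moreover have "h \<in> carrier PL_plus" "support h \<in> orbitals h" if "h \<in> C" for h
    using bump[of h] C(2) that by auto
  ultimately have "tower ?T"
    using C(3) unfolding tower_def signed_orbitals_def chain_of_def inj_on_def by blast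
  moreover have "card ?T = k"
    unfolding C(1) by (rule card_image) (auto intro: inj_onI)
  moreover have "?T \<subseteq> signed_orbitals_of Z"
    unfolding signed_orbitals_of_def using C(2) bump(2) by force
  ultimately show "k \<in> {height T | T. tower T \<and> T \<subseteq> signed_orbitals_of Z}"
    unfolding height_def by auto
qed

section \<open>The upper bound\<close>

text \<open>The induction is on the bound for chain lengths, with the family arbitrary, so that the
  hypothesis applies to the elements below each root.\<close>

lemma exp_derived_generate_trivial:
  assumes "finite Z" "nested_domains Z"
    and "\<And>C. C \<subseteq> Z \<Longrightarrow> chain_of C \<Longrightarrow> card C \<le> n"
  shows "(derived PL_plus ^^ n) (generate PL_plus Z) = {\<one>\<^bsub>PL_plus\<^esub>}"
  using assms
proof (induction n arbitrary: Z)
  case 0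
  have "Z = {}"
  proof (rule ccontr)
    assume "Z \<noteq> {}"
    then obtain z where "z \<in> Z" by auto
    then show False using 0(3)[of "{z}"] by (simp add: chain_of_def)
  qed
  then show ?case by (simp add: PL.generate_empty)
next
  case (Suc n)
  let ?G = PL_plus
  note nd = Suc.prems(2)[unfolded nested_domains_def]
  have Zc: "Z \<subseteq> carrier ?G" using nd by blast
  \<comment> \<open>\<open>R\<close> consists of the roots, and \<open>K (h, i)\<close> is
    \<open>L h\<close> conjugated by the \<open>i\<close>-th power of \<open>h\<close>. All integer
    exponents occur so that the family is invariant under conjugation by roots.\<close>
  define R where "R = {h \<in> Z. \<not> (\<exists>g\<in>Z. support h \<subset> support g)}"
  define below where "below h = {g \<in> Z. support g \<subset> support h}" for h
  define L where "L h = generate ?G (below h)" for h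
  define K where "K = (\<lambda>(h, i::int). (\<lambda>x. h [^]\<^bsub>?G\<^esub> i \<otimes>\<^bsub>?G\<^esub> x \<otimes>\<^bsub>?G\<^esub> inv\<^bsub>?G\<^esub> (h [^]\<^bsub>?G\<^esub> i)) ` L h)"
  define I where "I = R \<times> (UNIV :: int set)"
  have RZ: "R \<subseteq> Z" unfolding R_def by auto
  have Rc: "h \<in> carrier ?G" if "h \<in> R" for h using that RZ Zc by auto
  have bc: "below h \<subseteq> carrier ?G" for h using Zc unfolding below_def by auto
  have Lsub: "subgroup (L h) ?G" for h
    unfolding L_def by (rule PL.generate_is_subgroup[OF bc])
  have Lc: "L h \<subseteq> carrier ?G" for h using Lsub by (rule subgroup.subset)
  have root_disjoint: "support g \<inter> support h = {}" if "g \<in> R" "h \<in> R" "g \<noteq> h" for g h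
  proof -
    have "support g \<noteq> support h"
      using nd that RZ by (meson inj_on_eq_iff subsetD)
    moreover have "\<not> support g \<subset> support h" "\<not> support h \<subset> support g"
      using that unfolding R_def by auto
    ultimately show ?thesis
      using nd that RZ by blast
  qed
  have below_root: "\<exists>r\<in>R. z \<in> below r" if z: "z \<in> Z" "z \<notin> R" for z
  proof -
    \<comment> \<open>Maximality among the supports containing that of \<open>z\<close> is
      maximality in the whole family, since anything larger still contains it.\<close>
    have "\<exists>r\<in>{A \<in> support ` Z. support z \<subseteq> A}. support z \<subseteq> r \<and> (\<forall>b\<in>{A \<in> support ` Z. support z \<subseteq> A}. r \<subseteq> b \<longrightarrow> r = b)"
      by (rule finite_has_maximal2) (use Suc.prems(1) z in auto)
    then obtain r where r: "r \<in> Z" "support z \<subseteq> support r"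
      "\<And>g. g \<in> Z \<Longrightarrow> support z \<subseteq> support g \<Longrightarrow> support r \<subseteq> support g \<Longrightarrow> support r = support g"
      by auto
    have "r \<in> R"
      unfolding R_def using r by (auto simp: psubset_eq)
    moreover have "support z \<noteq> support r"
      using nd z r \<open>r \<in> R\<close> by (metis inj_on_eq_iff)
    ultimately show ?thesis
      unfolding below_def using z r by auto
  qed
  have Ksub: "subgroup (K p) ?G" if "p \<in> I" for p
    using group_hom.subgroup_img_is_subgroup[OF PL.group_hom_conj Lsub] that Rc
    unfolding K_def I_def by auto
  have Kc: "x \<in> carrier ?G" if "p \<in> I" "x \<in> K p" for p x
    using subgroup.mem_carrier[OF Ksub] that by auto
  have K_support: "support x \<subseteq> support h" if h: "h \<in> R" and x: "x \<in> K (h, i)" for h i x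
  proof -
    let ?S = "{f \<in> carrier ?G. support f \<subseteq> support h}"
    note S = subgroup_support_subset[of "support h"]
    have LS: "L h \<subseteq> ?S"
      unfolding L_def by (rule PL.generate_subgroup_incl[OF _ S]) (use Zc in \<open>auto simp: below_def\<close>)
    have hi: "h [^]\<^bsub>?G\<^esub> i \<in> ?S"
      by (rule PL.subgroup_int_pow_closed[OF S]) (use Rc h in auto)
    obtain y where y: "y \<in> L h" "x = h [^]\<^bsub>?G\<^esub> i \<otimes>\<^bsub>?G\<^esub> y \<otimes>\<^bsub>?G\<^esub> inv\<^bsub>?G\<^esub> (h [^]\<^bsub>?G\<^esub> i)"
      using x unfolding K_def by auto
    have "x \<in> ?S"
      unfolding y(2) by (intro subgroup.m_closed[OF S] subgroup.m_inv_closed[OF S] hi subsetD[OF LS y(1)])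
    then show ?thesis by simp
  qed
  have K_comm: "x \<otimes>\<^bsub>?G\<^esub> y = y \<otimes>\<^bsub>?G\<^esub> x"
    if pq: "p \<in> I" "q \<in> I" "p \<noteq> q" and xy: "x \<in> K p" "y \<in> K q" for p q x y
  proof -
    obtain g i h j where p: "p = (g, i)" "g \<in> R" and q: "q = (h, j)" "h \<in> R"
      using pq unfolding I_def by auto
    \<comment> \<open>Different roots have disjoint supports. For one root and different exponents,
      the supports lie in different translates of its fundamental domain.\<close>
    have "support x \<inter> support y = {}"
    proof (cases "g = h")
      case False
      have "support x \<subseteq> support g" "support y \<subseteq> support h"
        using K_support p q xy by blast+
      then show ?thesis using root_disjoint[OF p(2) q(2) False] by blast
    next
      case True
      then have ij: "i \<noteq> j" using p q pq by auto
      obtain r where r: "r \<in> {0..1}" "\<forall>g\<in>Z. support g \<subset> support h \<longrightarrow> support g \<subseteq> {r<..<h r}"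
        using nd q(2) RZ by blast
      have L: "support f \<subseteq> {r<..<h r}" if "f \<in> L h" for f
        using support_generate_subset[OF bc[of h], of "{r<..<h r}" f] r that
        unfolding L_def below_def by blast
      have K: "z \<in> {0..1} \<and> (h [^]\<^bsub>?G\<^esub> k) z \<in> {r<..<h r}" if f: "f \<in> K (h, k)" "z \<in> support f" for f k z
      proof -
        obtain f' where f': "f' \<in> L h" "f = h [^]\<^bsub>?G\<^esub> k \<otimes>\<^bsub>?G\<^esub> f' \<otimes>\<^bsub>?G\<^esub> inv\<^bsub>?G\<^esub> (h [^]\<^bsub>?G\<^esub> k)"
          using f(1) unfolding K_def by auto
        then have "support f = {x \<in> {0..1}. (h [^]\<^bsub>?G\<^esub> k) x \<in> support f'}"
          using support_conj[of f' "h [^]\<^bsub>?G\<^esub> k"] Lc Rc[OF q(2)] by auto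
        then show ?thesis using L[OF f'(1)] f(2) by auto
      qed
      have "x \<in> K (h, i)" "y \<in> K (h, j)" using xy p q True by simp_all
      then show ?thesis
        using fundamental_domain_disjoint[OF Rc[OF q(2)] r(1) ij] K by blast
    qed
    then show ?thesis
      by (intro disjoint_support_commute) (use Kc pq xy in auto)
  qed
  define T where "T = (\<Union>p\<in>I. K p)"
  have Tc: "T \<subseteq> carrier ?G" unfolding T_def using Kc by blast
  have below_T: "z \<in> generate ?G T" if z: "z \<in> Z" "z \<notin> R" for z
  proof -
    obtain r where r: "r \<in> R" "z \<in> below r" using below_root[OF z] by blast
    then have "z \<in> L r" unfolding L_def by (auto intro: generate.incl)
    \<comment> \<open>Exponent 0 recovers \<open>L r\<close> itself.\<close>
    then have "z \<in> K (r, 0)"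
      using z Zc unfolding K_def by (auto simp: image_iff intro!: bexI[of _ z])
    then have "z \<in> T" using r unfolding T_def I_def by blast
    then show ?thesis by (rule generate.incl)
  qed
  \<comment> \<open>Conjugation by \<open>h\<close> to the power \<open>e\<close> shifts the
    exponent of a factor of \<open>h\<close> by \<open>e\<close> and fixes every element of the
    factors of other roots.\<close>
  have root_conj: "h [^]\<^bsub>?G\<^esub> e \<otimes>\<^bsub>?G\<^esub> x \<otimes>\<^bsub>?G\<^esub> inv\<^bsub>?G\<^esub> (h [^]\<^bsub>?G\<^esub> e) \<in> T"
    if h: "h \<in> R" and x: "x \<in> T" for h x and e :: int
  proof -
    obtain g i where gi: "g \<in> R" "x \<in> K (g, i)" using x unfolding T_def I_def by auto
    show ?thesis
    proof (cases "g = h")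
      case True
      then obtain y where y: "y \<in> L h" "x = h [^]\<^bsub>?G\<^esub> i \<otimes>\<^bsub>?G\<^esub> y \<otimes>\<^bsub>?G\<^esub> inv\<^bsub>?G\<^esub> (h [^]\<^bsub>?G\<^esub> i)"
        using gi unfolding K_def by auto
      then have "h [^]\<^bsub>?G\<^esub> e \<otimes>\<^bsub>?G\<^esub> x \<otimes>\<^bsub>?G\<^esub> inv\<^bsub>?G\<^esub> (h [^]\<^bsub>?G\<^esub> e) =
          h [^]\<^bsub>?G\<^esub> (e + i) \<otimes>\<^bsub>?G\<^esub> y \<otimes>\<^bsub>?G\<^esub> inv\<^bsub>?G\<^esub> (h [^]\<^bsub>?G\<^esub> (e + i))"
        using Rc[OF h] Lc[of h] by (simp add: PL.conj_conj PL.int_pow_mult subset_iff)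
      then have "h [^]\<^bsub>?G\<^esub> e \<otimes>\<^bsub>?G\<^esub> x \<otimes>\<^bsub>?G\<^esub> inv\<^bsub>?G\<^esub> (h [^]\<^bsub>?G\<^esub> e) \<in> K (h, e + i)"
        using y unfolding K_def by auto
      then show ?thesis using h unfolding T_def I_def by blast
    next
      case False
      let ?S = "{f \<in> carrier ?G. support f \<subseteq> support h}"
      have p: "h [^]\<^bsub>?G\<^esub> e \<in> ?S"
        by (rule PL.subgroup_int_pow_closed[OF subgroup_support_subset]) (use Rc h in auto)
      have "support (h [^]\<^bsub>?G\<^esub> e) \<inter> support x = {}"
        using root_disjoint[OF gi(1) h False] K_support[OF gi] p by auto
      then have "h [^]\<^bsub>?G\<^esub> e \<otimes>\<^bsub>?G\<^esub> x \<otimes>\<^bsub>?G\<^esub> inv\<^bsub>?G\<^esub> (h [^]\<^bsub>?G\<^esub> e) = x"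
        using x Tc p by (intro PL.conj_eq_if_commute disjoint_support_commute) auto
      then show ?thesis using x by simp
    qed
  qed
  \<comment> \<open>\<open>generate T\<close> is normal in \<open>H = generate Z\<close>, and the quotient is abelian because the roots, which
    generate it, have disjoint supports.\<close>
  have N: "subgroup (generate ?G T) ?G" by (rule PL.generate_is_subgroup[OF Tc])
  have conj: "s \<otimes>\<^bsub>?G\<^esub> x \<otimes>\<^bsub>?G\<^esub> inv\<^bsub>?G\<^esub> s \<in> generate ?G T \<and> inv\<^bsub>?G\<^esub> s \<otimes>\<^bsub>?G\<^esub> x \<otimes>\<^bsub>?G\<^esub> s \<in> generate ?G T"
    if s: "s \<in> Z" and x: "x \<in> generate ?G T" for s x
  proof (cases "s \<in> R")
    case False
    then have "s \<in> generate ?G T" using below_T s by auto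
    then show ?thesis
      using x subgroup.m_closed[OF N] subgroup.m_inv_closed[OF N] by blast
  next
    case True
    have sc: "s \<in> carrier ?G" using s Zc by auto
    have "s [^]\<^bsub>?G\<^esub> e \<otimes>\<^bsub>?G\<^esub> x \<otimes>\<^bsub>?G\<^esub> inv\<^bsub>?G\<^esub> (s [^]\<^bsub>?G\<^esub> e) \<in> generate ?G T" for e :: int
      by (rule PL.conj_in_generate[OF Tc _ _ x]) (use sc root_conj[OF True] in \<open>auto intro: generate.incl\<close>)
    \<comment> \<open>Exponents 1 and -1 yield the two directions of conjugation.\<close>
    from this[of 1] this[of "-1"] show ?thesis
      using sc by (simp add: PL.int_pow_neg)
  qed
  have comm: "s \<otimes>\<^bsub>?G\<^esub> t \<otimes>\<^bsub>?G\<^esub> inv\<^bsub>?G\<^esub> s \<otimes>\<^bsub>?G\<^esub> inv\<^bsub>?G\<^esub> t \<in> generate ?G T" if st: "s \<in> Z" "t \<in> Z" for s t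
  proof -
    have c: "s \<in> carrier ?G" "t \<in> carrier ?G" using st Zc by auto
    \<comment> \<open>If one of the elements is not a root, it lies in the normalized subgroup and
      the commutator follows it there. Two roots commute.\<close>
    consider "s \<notin> R" | "t \<notin> R" | "s \<in> R" "t \<in> R" by blast
    then show ?thesis
    proof cases
      case 1
      then have "s \<in> generate ?G T" using below_T st by auto
      then have "s \<otimes>\<^bsub>?G\<^esub> (t \<otimes>\<^bsub>?G\<^esub> inv\<^bsub>?G\<^esub> s \<otimes>\<^bsub>?G\<^esub> inv\<^bsub>?G\<^esub> t) \<in> generate ?G T"
        by (intro subgroup.m_closed[OF N] conjunct1[OF conj[OF st(2)]] subgroup.m_inv_closed[OF N])
      then show ?thesis using c by (simp add: PL.m_assoc)
    next
      case 2
      then have t: "t \<in> generate ?G T" using below_T st by auto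
      show ?thesis
        by (intro subgroup.m_closed[OF N conjunct1[OF conj[OF st(1) t]]] subgroup.m_inv_closed[OF N t])
    next
      case 3
      have "s \<otimes>\<^bsub>?G\<^esub> t = t \<otimes>\<^bsub>?G\<^esub> s"
        using disjoint_support_commute[OF c] root_disjoint[OF 3] by (cases "s = t") auto
      then have "s \<otimes>\<^bsub>?G\<^esub> t \<otimes>\<^bsub>?G\<^esub> inv\<^bsub>?G\<^esub> s = t"
        using c by (intro PL.conj_eq_if_commute) auto
      then show ?thesis using c by (simp add: generate.one)
    qed
  qed
  have derived_L: "(derived ?G ^^ n) (L h) = {\<one>\<^bsub>?G\<^esub>}" if h: "h \<in> R" for h
    unfolding L_def
  proof (rule Suc.IH)
    show "finite (below h)" using Suc.prems(1) unfolding below_def by simp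
    show "nested_domains (below h)"
      by (rule nested_domains_subset[OF Suc.prems(2)]) (auto simp: below_def)
    fix C assume C: "C \<subseteq> below h" "chain_of C"
    \<comment> \<open>Placing \<open>h\<close> on top of a chain below it gives a chain in
      \<open>Z\<close> with one more element, which lowers the bound to \<open>n\<close>.\<close>
    have "card (insert h C) \<le> Suc n"
      using C RZ h by (intro Suc.prems(3)) (auto simp: below_def chain_of_def)
    moreover have "h \<notin> C" "finite C"
      using C \<open>finite (below h)\<close> finite_subset by (auto simp: below_def)
    ultimately show "card C \<le> n" by simp
  qed
  \<comment> \<open>Conjugation is a homomorphism, so the derived series of \<open>K p\<close> is
    the image of that of \<open>L h\<close>.\<close>
  have "(derived ?G ^^ n) (K p) = {\<one>\<^bsub>?G\<^esub>}" if pI: "p \<in> I" for p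
  proof -
    obtain h i where p: "p = (h, i)" "h \<in> R" using pI unfolding I_def by auto
    have c: "h [^]\<^bsub>?G\<^esub> i \<in> carrier ?G" using Rc p by simp
    show ?thesis
      using group_hom.exp_of_derived_img[OF PL.group_hom_conj[OF c] Lc[of h], of n] derived_L[OF p(2)] c
      unfolding K_def p by simp
  qed
  then have trivial: "(\<Union>p\<in>I. (derived ?G ^^ n) (K p)) \<subseteq> {\<one>\<^bsub>?G\<^esub>}" by auto
  have "(derived ?G ^^ n) (generate ?G T) \<subseteq> generate ?G (\<Union>p\<in>I. (derived ?G ^^ n) (K p))"
    unfolding T_def by (rule PL.exp_derived_generate_UN_commuting) (fact Ksub, rule K_comm)
  also have "\<dots> \<subseteq> generate ?G {\<one>\<^bsub>?G\<^esub>}"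
    by (rule PL.mono_generate[OF trivial])
  finally have "(derived ?G ^^ n) (generate ?G T) \<subseteq> generate ?G {\<one>\<^bsub>?G\<^esub>}" .
  \<comment> \<open>The first of the \<open>Suc n\<close> derivations leads into
    \<open>generate ?G T\<close>; the remaining \<open>n\<close> trivialize its factors.\<close>
  moreover have "(derived ?G ^^ Suc n) (generate ?G Z) \<subseteq> (derived ?G ^^ n) (generate ?G T)"
    using PL.mono_exp_of_derived[OF PL.derived_generate_subset[OF Zc N conj comm]]
    by (simp add: funpow_swap1)
  ultimately have "(derived ?G ^^ Suc n) (generate ?G Z) \<subseteq> {\<one>\<^bsub>?G\<^esub>}"
    by (simp add: PL.generate_one)
  moreover have "\<one>\<^bsub>?G\<^esub> \<in> (derived ?G ^^ Suc n) (generate ?G Z)"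
    by (rule subgroup.one_closed[OF PL.exp_of_derived_is_subgroup[OF PL.generate_is_subgroup[OF Zc]]])
  ultimately show ?case by blast
qed

section \<open>The lower bound\<close>

text \<open>
  Restriction to \<open>D\<close> is a homomorphism only on the stabilizer of \<open>D\<close>, which need not contain the
  commutators used below; hence a relation in which only the first map has to preserve \<open>D\<close>.
\<close>

definition agree_on :: "real set \<Rightarrow> (real \<Rightarrow> real) \<Rightarrow> (real \<Rightarrow> real) \<Rightarrow> bool" where
  "agree_on D f g \<longleftrightarrow> f \<in> carrier PL_plus \<and> g \<in> carrier PL_plus \<and> f ` D = D \<and> (\<forall>x\<in>D. g x = f x)"

lemma agree_on_one:
  assumes "D \<subseteq> {0..1}"
  shows "agree_on D \<one>\<^bsub>PL_plus\<^esub> \<one>\<^bsub>PL_plus\<^esub>"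
proof -
  have "\<one>\<^bsub>PL_plus\<^esub> ` D = (\<lambda>x. x) ` D"
    using assms PL_plus_one_apply by (intro image_cong) auto
  then show ?thesis by (simp add: agree_on_def)
qed

text \<open>Invariance of \<open>D\<close> under \<open>f\<close> puts \<open>f x\<close> back in
  \<open>D\<close>, where \<open>f'\<close> and \<open>g'\<close> agree.\<close>

lemma agree_on_mult:
  assumes D: "D \<subseteq> {0..1}" and "agree_on D f g" "agree_on D f' g'"
  shows "agree_on D (f \<otimes>\<^bsub>PL_plus\<^esub> f') (g \<otimes>\<^bsub>PL_plus\<^esub> g')"
proof -
  have f: "f ` D = D" "f' ` D = D" "\<And>x. x \<in> D \<Longrightarrow> g x = f x" "\<And>x. x \<in> D \<Longrightarrow> g' x = f' x"
    using assms unfolding agree_on_def by auto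
  have app: "(a \<otimes>\<^bsub>PL_plus\<^esub> b) x = b (a x)" if "x \<in> D" for a b x
    using PL_plus_mult_apply D that by blast
  have "(f \<otimes>\<^bsub>PL_plus\<^esub> f') ` D = f' ` f ` D"
    unfolding image_image by (intro image_cong) (auto simp: app)
  moreover have "(g \<otimes>\<^bsub>PL_plus\<^esub> g') x = (f \<otimes>\<^bsub>PL_plus\<^esub> f') x" if x: "x \<in> D" for x
  proof -
    have "f x \<in> D" using f(1) x by blast
    then show ?thesis using f x by (simp add: app)
  qed
  ultimately show ?thesis using assms f unfolding agree_on_def by auto
qed

lemma agree_on_inv:
  assumes D: "D \<subseteq> {0..1}" and "agree_on D f g"
  shows "agree_on D (inv\<^bsub>PL_plus\<^esub> f) (inv\<^bsub>PL_plus\<^esub> g)"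
proof -
  have c: "f \<in> carrier PL_plus" "g \<in> carrier PL_plus" and f: "f ` D = D" "\<And>x. x \<in> D \<Longrightarrow> g x = f x"
    using assms unfolding agree_on_def by auto
  have inv: "(inv\<^bsub>PL_plus\<^esub> f) (f x) = x" "(inv\<^bsub>PL_plus\<^esub> g) (g x) = x" if "x \<in> D" for x
    using PL_plus_inv_apply(2) c D that by blast+
  have "(inv\<^bsub>PL_plus\<^esub> f) ` f ` D = (\<lambda>x. x) ` D"
    unfolding image_image using inv by (intro image_cong) auto
  then have "(inv\<^bsub>PL_plus\<^esub> f) ` D = D" using f(1) by simp
  moreover have "(inv\<^bsub>PL_plus\<^esub> g) x = (inv\<^bsub>PL_plus\<^esub> f) x" if x: "x \<in> D" for x
  proof -
    obtain y where "y \<in> D" "x = f y" using f(1) x by (metis imageE)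
    then show ?thesis using inv f(2) by metis
  qed
  ultimately show ?thesis using c unfolding agree_on_def by auto
qed

text \<open>Replacing each element of \<open>U\<close> in a word of commutators by a partner from
  \<open>V\<close> gives the matching word, since agreement respects products and inverses.\<close>

lemma agree_on_derived:
  assumes D: "D \<subseteq> {0..1}" and agree: "\<And>u. u \<in> U \<Longrightarrow> \<exists>v\<in>V. agree_on D u v"
    and "u \<in> derived PL_plus U"
  shows "\<exists>v\<in>derived PL_plus V. agree_on D u v"
  using assms(3) unfolding derived_def
proof (induction rule: generate.induct)
  case one
  then show ?case using agree_on_one[OF D] generate.one by blast
next
  case (incl h)
  then obtain a b where ab: "a \<in> U" "b \<in> U"
      "h = a \<otimes>\<^bsub>PL_plus\<^esub> b \<otimes>\<^bsub>PL_plus\<^esub> inv\<^bsub>PL_plus\<^esub> a \<otimes>\<^bsub>PL_plus\<^esub> inv\<^bsub>PL_plus\<^esub> b"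
    by auto
  obtain a' b' where ab': "a' \<in> V" "b' \<in> V" "agree_on D a a'" "agree_on D b b'"
    using agree ab by blast
  let ?h = "a' \<otimes>\<^bsub>PL_plus\<^esub> b' \<otimes>\<^bsub>PL_plus\<^esub> inv\<^bsub>PL_plus\<^esub> a' \<otimes>\<^bsub>PL_plus\<^esub> inv\<^bsub>PL_plus\<^esub> b'"
  have "agree_on D h ?h"
    unfolding ab(3) by (intro agree_on_mult agree_on_inv D ab')
  moreover have "?h \<in> generate PL_plus (derived_set PL_plus V)"
    by (rule generate.incl) (use ab' in auto)
  ultimately show ?case by blast
next
  case (inv h)
  then obtain a b where ab: "a \<in> U" "b \<in> U"
      "h = a \<otimes>\<^bsub>PL_plus\<^esub> b \<otimes>\<^bsub>PL_plus\<^esub> inv\<^bsub>PL_plus\<^esub> a \<otimes>\<^bsub>PL_plus\<^esub> inv\<^bsub>PL_plus\<^esub> b"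
    by auto
  obtain a' b' where ab': "a' \<in> V" "b' \<in> V" "agree_on D a a'" "agree_on D b b'"
    using agree ab by blast
  let ?h = "a' \<otimes>\<^bsub>PL_plus\<^esub> b' \<otimes>\<^bsub>PL_plus\<^esub> inv\<^bsub>PL_plus\<^esub> a' \<otimes>\<^bsub>PL_plus\<^esub> inv\<^bsub>PL_plus\<^esub> b'"
  have "agree_on D (inv\<^bsub>PL_plus\<^esub> h) (inv\<^bsub>PL_plus\<^esub> ?h)"
    unfolding ab(3) by (intro agree_on_mult agree_on_inv D ab')
  moreover have "inv\<^bsub>PL_plus\<^esub> ?h \<in> generate PL_plus (derived_set PL_plus V)"
    by (rule generate.inv) (use ab' in auto)
  ultimately show ?case by blast
next
  case (eng h k)
  then show ?case using agree_on_mult[OF D] generate.eng by meson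
qed

lemma agree_on_exp_derived:
  assumes D: "D \<subseteq> {0..1}" and agree: "\<And>u. u \<in> U \<Longrightarrow> \<exists>v\<in>V. agree_on D u v"
    and "u \<in> (derived PL_plus ^^ n) U"
  shows "\<exists>v\<in>(derived PL_plus ^^ n) V. agree_on D u v"
  using assms(3)
proof (induction n arbitrary: u)
  case (Suc n)
  show ?case
    using agree_on_derived[OF D Suc.IH] Suc.prems by simp
qed (use agree in simp)

text \<open>Removing the top of the chain costs one derivation: on the fundamental domain of the
  top, commutators with it already realize the group of the shorter chain. A single nontrivial
  element starts the induction.\<close>

lemma exp_derived_generate_chain_nontrivial:
  assumes "nested_domains C" "chain_of C" "card C = Suc n"
  shows "(derived PL_plus ^^ n) (generate PL_plus C) \<noteq> {\<one>\<^bsub>PL_plus\<^esub>}"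
  using assms
proof (induction n arbitrary: C)
  case 0
  then obtain h where h: "h \<in> C" by fastforce
  then have "h \<noteq> \<one>\<^bsub>PL_plus\<^esub>"
    using 0(1) support_eq_empty_iff[of h] unfolding nested_domains_def by blast
  moreover have "h \<in> generate PL_plus C" using h by (rule generate.incl)
  ultimately show ?case by auto
next
  case (Suc n)
  let ?G = PL_plus
  note nd = Suc.prems(1)[unfolded nested_domains_def]
  have Cc: "C \<subseteq> carrier ?G" using nd by blast
  have fin: "finite C" "C \<noteq> {}" using Suc.prems(3) card.infinite by fastforce+
  obtain h where h: "h \<in> C" "\<And>g. g \<in> C \<Longrightarrow> support h \<subseteq> support g \<Longrightarrow> support h = support g"
    using finite_has_maximal[of "support ` C"] fin by auto
  define C' where "C' = C - {h}"
  have below: "support g \<subset> support h" if "g \<in> C'" for g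
  proof -
    have "support g \<noteq> support h"
      using that h nd unfolding C'_def by (metis DiffE inj_on_eq_iff singletonI)
    then show ?thesis
      using h that Suc.prems(2) unfolding C'_def chain_of_def by blast
  qed
  have C': "nested_domains C'" "chain_of C'" "card C' = Suc n" "C' \<subseteq> carrier ?G"
    using Suc.prems nested_domains_subset[of C C'] h(1) Cc by (auto simp: C'_def chain_of_def)
  have hc: "h \<in> carrier ?G" using h Cc by auto
  obtain r where r: "r \<in> {0..1}" "\<And>g. g \<in> C \<Longrightarrow> support g \<subset> support h \<Longrightarrow> support g \<subseteq> {r<..<h r}"
    using nd h(1) by meson
  define D where "D = {r<..<h r}"
  have hr: "h r \<in> {0..1}" by (rule PL_plus_closed[OF hc r(1)])
  have D: "D \<subseteq> {0..1}" using r(1) hr unfolding D_def by auto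
  have supp: "support x \<subseteq> D" if "x \<in> generate ?G C'" for x
    by (rule support_generate_subset[OF C'(4) _ that])
      (use below r(2) in \<open>auto simp: D_def C'_def\<close>)
  have "\<exists>y\<in>derived ?G (generate ?G C). agree_on D x y" if x: "x \<in> generate ?G C'" for x
  proof
    have xc: "x \<in> carrier ?G" using x C' PL.generate_in_carrier by blast
    have xC: "x \<in> generate ?G C" using x PL.mono_generate[of C' C] unfolding C'_def by blast
    \<comment> \<open>\<open>h\<close> moves \<open>D\<close> off itself, so on \<open>D\<close> the factor \<open>inv x\<close> of the commutator is invisible.\<close>
    let ?y = "x \<otimes>\<^bsub>?G\<^esub> h \<otimes>\<^bsub>?G\<^esub> inv\<^bsub>?G\<^esub> x \<otimes>\<^bsub>?G\<^esub> inv\<^bsub>?G\<^esub> h"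
    show "?y \<in> derived ?G (generate ?G C)"
      unfolding derived_def by (rule generate.incl) (use xC h(1) generate.incl[of h C ?G] in auto)
    have im: "x ` D = D" using support_image[OF xc supp[OF x] D] .
    have "?y t = x t" if t: "t \<in> D" for t
    proof -
      have t01: "t \<in> {0..1}" and xt: "x t \<in> D" "x t \<in> {0..1}" using t D im by blast+
      have "h r < h (x t)"
        using PL_plus_less_iff[OF hc r(1) xt(2)] xt(1) unfolding D_def by simp
      then have "h (x t) \<notin> support (inv\<^bsub>?G\<^esub> x)"
        using supp[OF x] unfolding support_inv[OF xc] D_def by auto
      then have "(inv\<^bsub>?G\<^esub> x) (h (x t)) = h (x t)"
        using not_in_support PL_plus_closed[OF hc xt(2)] by blast
      then show ?thesis
        using t01 PL_plus_inv_apply(2)[OF hc xt(2)] by (simp add: PL_plus_mult_apply)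
    qed
    then show "agree_on D x ?y"
      using xc hc im unfolding agree_on_def by simp
  qed
  \<comment> \<open>The larger side starts at the derived subgroup of \<open>generate ?G C\<close>,
    so \<open>n\<close> derivations of the smaller group match \<open>Suc n\<close> of the larger
    one.\<close>
  note lift = agree_on_exp_derived[OF D this]
  have sub: "subgroup ((derived ?G ^^ n) (generate ?G C')) ?G"
    by (rule PL.exp_of_derived_is_subgroup[OF PL.generate_is_subgroup[OF C'(4)]])
  obtain x where x: "x \<in> (derived ?G ^^ n) (generate ?G C')" "x \<noteq> \<one>\<^bsub>?G\<^esub>"
    using Suc.IH[OF C'(1-3)] subgroup.one_closed[OF sub] by blast
  have "x \<in> carrier ?G" using subgroup.mem_carrier[OF sub x(1)] .
  \<comment> \<open>A moved point of \<open>x\<close> lies in \<open>D\<close>, where the partner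
    \<open>y\<close> has the same values, so \<open>y\<close> is nontrivial too.\<close>
  then obtain t where t: "t \<in> support x"
    using x(2) support_eq_empty_iff by blast
  have "(derived ?G ^^ n) (generate ?G C') \<subseteq> generate ?G C'"
    by (rule PL.exp_derived_incl[OF PL.generate_is_subgroup[OF C'(4)]])
  then have tD: "t \<in> D" using supp x(1) t by blast
  obtain y where y: "y \<in> (derived ?G ^^ n) (derived ?G (generate ?G C))" "agree_on D x y"
    using lift[OF _ x(1)] by blast
  have "y t = x t" using y(2) tD unfolding agree_on_def by blast
  then have "y t \<noteq> t" "t \<in> {0..1}" using t unfolding support_def by auto
  then have "y \<noteq> \<one>\<^bsub>?G\<^esub>" using PL_plus_one_apply by metis
  moreover have "y \<in> (derived ?G ^^ Suc n) (generate ?G C)"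
    using y(1) by (simp add: funpow_swap1)
  ultimately show ?case by blast
qed

section \<open>The derived length\<close>

theorem lemma4p3:
  fixes Z H :: "(real \<Rightarrow> real) set"
  assumes "finite Z"
    and "one_bump_with_fundamental_domains Z"
    and "H = generate PL_plus Z"
  shows "solvable (PL_plus\<lparr>carrier := H\<rparr>) \<and>
         derived_length (PL_plus\<lparr>carrier := H\<rparr>) =
           Max {height T | T. tower T \<and> T \<subseteq> signed_orbitals_of Z}"
proof -
  let ?G = PL_plus
  let ?X = "{height T | T. tower T \<and> T \<subseteq> signed_orbitals_of Z}"
  define N where "N = Max ?X"
  note X = tower_heights_eq_card_chains[OF assms(2)]
  have nd: "nested_domains Z" by (rule one_bump_imp_nested_domains[OF assms(2)])
  have H: "subgroup H ?G"
    unfolding assms(3) using nd by (intro PL.generate_is_subgroup) (simp add: nested_domains_def)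
  interpret H: group "?G\<lparr>carrier := H\<rparr>"
    by (rule PL.subgroup_imp_group[OF H])
  have fin: "finite ?X" unfolding X using assms(1) by auto
  \<comment> \<open>The empty chain makes the set of heights nonempty, so the maximum is attained
    even if \<open>Z\<close> is empty.\<close>
  have "card ({} :: (real \<Rightarrow> real) set) \<in> ?X" unfolding X by (intro imageI) (simp add: chain_of_def)
  then have "N \<in> ?X" unfolding N_def using fin by (intro Max_in) auto
  then obtain C where C: "C \<subseteq> Z" "chain_of C" "card C = N" unfolding X by auto
  have "card C \<le> N" if "C \<subseteq> Z" "chain_of C" for C
    unfolding N_def by (rule Max_ge[OF fin]) (use that in \<open>auto simp: X\<close>)
  then have trivial: "(derived ?G ^^ N) H = {\<one>\<^bsub>?G\<^esub>}"
    unfolding assms(3) by (rule exp_derived_generate_trivial[OF assms(1) nd])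
  have "N \<le> k" if k: "(derived ?G ^^ k) H = {\<one>\<^bsub>?G\<^esub>}" for k
  proof (rule ccontr)
    assume "\<not> N \<le> k"
    \<comment> \<open>A series trivial at stage \<open>k\<close> is still trivial at stage
      \<open>N - 1\<close>, but the subgroup of a longest chain with \<open>N\<close> elements is
      nontrivial there.\<close>
    then obtain n where n: "N = Suc n" "k \<le> n" by (cases N) auto
    have "C \<subseteq> carrier ?G" using C(1) nd unfolding nested_domains_def by blast
    then have "\<one>\<^bsub>?G\<^esub> \<in> (derived ?G ^^ n) (generate ?G C)"
      by (intro subgroup.one_closed PL.exp_of_derived_is_subgroup PL.generate_is_subgroup)
    moreover have "(derived ?G ^^ n) (generate ?G C) \<subseteq> (derived ?G ^^ n) H"
      unfolding assms(3) by (intro PL.mono_exp_of_derived PL.mono_generate C)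
    moreover have "(derived ?G ^^ n) H = {\<one>\<^bsub>?G\<^esub>}"
      by (rule PL.exp_derived_trivial_mono[OF H k n(2)])
    ultimately have "(derived ?G ^^ n) (generate ?G C) = {\<one>\<^bsub>?G\<^esub>}" by blast
    then show False
      using exp_derived_generate_chain_nontrivial[OF nested_domains_subset[OF nd C(1)] C(2)] C(3) n by simp
  qed
  then have "derived_length (?G\<lparr>carrier := H\<rparr>) = N"
    unfolding derived_length_def using trivial PL.exp_derived_consistent[OF H]
    by (intro Least_equality) auto
  moreover have "solvable (?G\<lparr>carrier := H\<rparr>)"
    unfolding H.solvable_iff_trivial_derived_seq using trivial PL.exp_derived_consistent[OF H] by auto
  ultimately show ?thesis unfolding N_def by simp
qed

end
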